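(* Let $p,n\in\mathbb{N}$, let $q$ be univalent (analytic and injective) in $\mathbb{U}$, $\mu\in\mathbb{C}\setminus\{0\}$, $\alpha\ge0$, $\beta\in\mathbb{R}$ and $\alpha+i\beta\neq0$. Suppose that $q$ satisfies $$\operatorname{Re}\left\{1+\frac{zq''(z)}{q'(z)}\right\}>\max\left\{0,-\operatorname{Re}\left\{\frac{p(\alpha+i\beta)}{\mu}\right\}\right\}\quad(z\in\mathbb{U}).$$ If $f\in\mathcal{A}_p$ satisfies the subordination $$(1+\mu)\left(\frac{z^{p}}{f(z)}\right)^{\alpha+i\beta}-\mu\left(\frac{zf'(z)}{pf(z)}\right)\left(\frac{z^{p}}{f(z)}\right)^{\alpha+i\beta}\prec q(z)+\mu\frac{zq'(z)}{p(\alpha+i\beta)},$$ then $$\left(\frac{z^{p}}{f(z)}\right)^{\alpha+i\beta}\prec q(z),$$ and $q$ is the best dominant.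
   Context: $\mathbb{U}=\{z\in\mathbb{C}:|z|<1\}$ and $\mathbb{N}=\{1,2,3,\dots\}$. For $p,n\in\mathbb{N}$, $\mathcal{A}_p$ is the class of functions $f(z)=z^{p}+\sum_{k=n}^{\infty}a_{k+p}z^{k+p}$ that are analytic and $p$-valent in $\mathbb{U}$ ($p$-valent: no value is taken more than $p$ times, counted with multiplicity, and some value is taken exactly $p$ times; in particular $f(z)\neq0$ for $z\in\mathbb{U}\setminus\{0\}$). The function $z^p/f(z)$ is extended by the value $1$ at $z=0$. All powers are principal values (so $(z^p/f(z))^{\alpha+i\beta}$ equals $1$ at $z=0$), and it is part of the convention that $(z^p/f(z))^{\alpha+i\beta}$ is analytic in $\mathbb{U}$. For $F,G$ analytic in $\mathbb{U}$, $F\prec G$ ($F$ is subordinate to $G$) means there is an analytic $w:\mathbb{U}\to\mathbb{C}$ with $w(0)=0$, $|w(z)|<1$ on $\mathbb{U}$, and $F(z)=G(w(z))$ for all $z\in\mathbb{U}$. Best dominant (standard Miller–Mocanu sense): with $\Phi(z)=(z^p/f(z))^{\alpha+i\beta}$, the hypothesis is the differential subordination $\Phi(z)+\frac{\mu}{p(\alpha+i\beta)}z\Phi'(z)\prec q(z)+\frac{\mu}{p(\alpha+i\beta)}zq'(z)$. A univalent function $r$ on $\mathbb{U}$ is a dominant of it if $\Phi\prec r$ for every analytic $\Phi$ on $\mathbb{U}$ satisfying this differential subordination; a dominant $q$ is the best dominant if $q\prec r$ for every dominant $r$. *)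

theory Defs
  imports "HOL-Complex_Analysis.Complex_Analysis"
begin

abbreviation unit_disc :: "complex set" where
  "unit_disc \<equiv> ball 0 1"

definition univalent :: "(complex \<Rightarrow> complex) \<Rightarrow> bool" where
  "univalent g \<longleftrightarrow> g holomorphic_on unit_disc \<and> inj_on g unit_disc"

definition fibre :: "(complex \<Rightarrow> complex) \<Rightarrow> complex \<Rightarrow> complex set" where
  "fibre f w = {z \<in> unit_disc. f z = w}"

text \<open>The number of solutions of \<open>f z = w\<close> in the disc, counted with multiplicity.
  It is only meaningful when the fibre is finite, a condition that is therefore required
  separately below; that condition also excludes constant functions, for which
  \<^const>\<open>zorder\<close> would be unspecified.\<close>
definition valence :: "(complex \<Rightarrow> complex) \<Rightarrow> complex \<Rightarrow> nat" where
  "valence f w = (\<Sum>z\<in>fibre f w. nat (zorder (\<lambda>u. f u - w) z))"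

definition p_valent :: "nat \<Rightarrow> (complex \<Rightarrow> complex) \<Rightarrow> bool" where
  "p_valent p f \<longleftrightarrow> f holomorphic_on unit_disc \<and>
     (\<forall>w. finite (fibre f w) \<and> valence f w \<le> p) \<and> (\<exists>w. valence f w = p)"

definition class_A :: "nat \<Rightarrow> nat \<Rightarrow> (complex \<Rightarrow> complex) set" where
  "class_A p n = {f. p_valent p f \<and>
     (\<exists>a :: nat \<Rightarrow> complex. \<forall>z\<in>unit_disc.
        (\<lambda>k. a (n + k + p) * z ^ (n + k + p)) sums (f z - z ^ p))}"

text \<open>For \<open>f\<close> in \<^const>\<open>class_A\<close>, the quotients \<open>z ^ p / f z\<close> and
  \<open>z * f' z / (p * f z)\<close> both have a removable singularity at \<open>0\<close> with limit \<open>1\<close>.\<close>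
definition quot :: "nat \<Rightarrow> (complex \<Rightarrow> complex) \<Rightarrow> complex \<Rightarrow> complex" where
  "quot p f z = (if z = 0 then 1 else z ^ p / f z)"

definition log_quot :: "nat \<Rightarrow> (complex \<Rightarrow> complex) \<Rightarrow> complex \<Rightarrow> complex" where
  "log_quot p f z = (if z = 0 then 1 else z * deriv f z / (of_nat p * f z))"

definition subordinate :: "(complex \<Rightarrow> complex) \<Rightarrow> (complex \<Rightarrow> complex) \<Rightarrow> bool"
    (infix "\<prec>" 50) where
  "F \<prec> G \<longleftrightarrow> F holomorphic_on unit_disc \<and> G holomorphic_on unit_disc \<and>
     (\<exists>w. w holomorphic_on unit_disc \<and> w 0 = 0 \<and>
          (\<forall>z\<in>unit_disc. norm (w z) < 1) \<and> (\<forall>z\<in>unit_disc. F z = G (w z)))"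

text \<open>The predicate \<open>D\<close> stands for a differential subordination in the unknown
  function \<open>\<Phi>\<close>.\<close>
definition dominant ::
    "((complex \<Rightarrow> complex) \<Rightarrow> bool) \<Rightarrow> (complex \<Rightarrow> complex) \<Rightarrow> bool" where
  "dominant D r \<longleftrightarrow> univalent r \<and>
     (\<forall>\<Phi>. \<Phi> holomorphic_on unit_disc \<longrightarrow> D \<Phi> \<longrightarrow> \<Phi> \<prec> r)"

definition best_dominant ::
    "((complex \<Rightarrow> complex) \<Rightarrow> bool) \<Rightarrow> (complex \<Rightarrow> complex) \<Rightarrow> bool" where
  "best_dominant D q \<longleftrightarrow> dominant D q \<and> (\<forall>r. dominant D r \<longrightarrow> q \<prec> r)"

end

theory Submission
  imports Defs
begin

text \<open>
  The condition on \<open>q\<close> makes every \<open>q ` ball 0 r\<close> convex with outward normal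
  \<open>k (q \<zeta>) = \<zeta> q' \<zeta>\<close>, and it makes \<open>k + id / \<gamma>\<close>, where \<open>\<gamma> = \<mu> / (p (\<alpha> + i\<beta>))\<close>, strictly
  monotone on the convex set \<open>q ` unit_disc\<close>. Suppose that \<open>\<Phi> + \<gamma> z \<Phi>' = (q + \<gamma> z q') \<circ> w\<close>
  and that \<open>\<Phi>\<close> first leaves \<open>q ` ball 0 \<rho>\<close> at \<open>z\<^sub>0\<close>, through the boundary point \<open>x = q \<zeta>\<close>. Jack's
  lemma gives \<open>z\<^sub>0 \<Phi>' z\<^sub>0 = m k x\<close> with \<open>m \<ge> 1\<close>, so \<open>x + \<gamma> m k x = y + \<gamma> k y\<close> for the interior
  point \<open>y = q (w z\<^sub>0)\<close>, that is, \<open>(x - y) / \<gamma> + k x - k y = - (m - 1) k x\<close>. Paired with \<open>x - y\<close>,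
  the left-hand side is positive by monotonicity and the right-hand side is nonpositive by
  convexity, a contradiction. No subordination chains are needed.
  Since \<open>q\<close> itself satisfies the differential subordination, it is the best dominant.
\<close>

section \<open>Derivatives along paths and Jack's lemma\<close>

lemma has_real_derivative_Re_path:
  assumes "(g has_field_derivative D) (at (c t))" "(c has_vector_derivative c') (at t)"
  shows "((\<lambda>s. Re (g (c s))) has_real_derivative Re (c' * D)) (at t)"
  using has_field_derivative_Re[OF field_vector_diff_chain_at[OF assms(2,1)]]
  by (simp add: o_def)

lemma circle_path_has_vector_derivative:
  "((\<lambda>t. of_real r * cis t) has_vector_derivative \<i> * (of_real r * cis t)) (at t)"
proof -
  have "(cis has_vector_derivative \<i> * cis t) (at t)"
    by (simp add: has_vector_derivative_complex_iff)
  from has_vector_derivative_mult_right[OF this, of "of_real r"] show ?thesis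
    by (simp add: mult_ac)
qed

text \<open>With the contact point rescaled to \<open>1\<close>, the Schwarz lemma bounds the
  function by the modulus. So \<open>1\<close> maximises its real part on the unit circle, which
  makes the derivative there real, and comparison along the radius makes it at least
  \<open>1\<close>.\<close>

lemma Jack_lemma:
  fixes \<omega> :: "complex \<Rightarrow> complex"
  assumes hol: "\<omega> holomorphic_on S" "open S" "cball 0 (norm z0) \<subseteq> S" and "\<omega> 0 = 0" "z0 \<noteq> 0"
    and less: "\<And>z. norm z < norm z0 \<Longrightarrow> norm (\<omega> z) < norm (\<omega> z0)"
  obtains m :: real where "m \<ge> 1" "z0 * deriv \<omega> z0 = of_real m * \<omega> z0"
proof -
  have nz: "\<omega> z0 \<noteq> 0"
    using less[of 0] \<open>z0 \<noteq> 0\<close> \<open>\<omega> 0 = 0\<close> by auto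
  define F where "F = (\<lambda>\<zeta>. \<omega> (z0 * \<zeta>) / \<omega> z0)"
  define D where "D = z0 * deriv \<omega> z0 / \<omega> z0"
  have inS: "z0 * \<zeta> \<in> S" if "norm \<zeta> \<le> 1" for \<zeta>
    using that hol(3) by (auto simp: subset_iff norm_mult mult_left_le)
  have F1: "(F has_field_derivative D) (at 1)"
  proof -
    have "((*) z0 has_field_derivative z0) (at 1)"
      by (auto intro!: derivative_eq_intros)
    then have "((\<lambda>\<zeta>. \<omega> (z0 * \<zeta>)) has_field_derivative deriv \<omega> z0 * z0) (at 1)"
      by (rule DERIV_chain2[rotated]) (use inS[of 1] in \<open>auto intro: holomorphic_derivI[OF hol(1,2)]\<close>)
    from DERIV_cdivide[OF this, of "\<omega> z0"] show ?thesis
      by (simp add: F_def D_def mult.commute)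
  qed
  have "F holomorphic_on ball 0 1"
    unfolding F_def using nz
    by (intro holomorphic_intros holomorphic_on_compose_gen[OF _ hol(1), unfolded o_def])
      (auto intro!: inS)
  moreover have "norm (F z) < 1" if "norm z < 1" for z
    using less[of "z0 * z"] that \<open>z0 \<noteq> 0\<close> nz by (simp add: F_def norm_mult norm_divide)
  ultimately have Schw: "norm (F z) \<le> norm z" if "norm z < 1" for z
    using Schwarz_Lemma(1)[of F z] that \<open>\<omega> 0 = 0\<close> by (simp add: F_def)
  have Fle: "norm (F z) \<le> 1" if "norm z \<le> 1" for z
  proof -
    have cF: "continuous_on (cball 0 1) F"
      unfolding F_def using nz
      by (intro continuous_intros continuous_on_compose2[OF holomorphic_on_imp_continuous_on[OF hol(1)]])
        (auto intro!: inS)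
    have "continuous_on (closure (ball 0 1)) (\<lambda>z. norm (F z))"
      using cF by (auto intro: continuous_intros)
    then show ?thesis
      by (rule continuous_le_on_closure)
        (use that Schw in \<open>auto intro: order_trans less_imp_le\<close>)
  qed
  have "F 1 = 1" using nz by (simp add: F_def)
  have "((\<lambda>t. Re (F (of_real 1 * cis t))) has_real_derivative Re (\<i> * (of_real 1 * cis 0) * D)) (at 0)"
    by (rule has_real_derivative_Re_path[OF _ circle_path_has_vector_derivative]) (simp add: F1)
  then have "Re (\<i> * (of_real 1 * cis 0) * D) = 0"
  proof (rule DERIV_local_max[where d = 1])
    show "\<forall>y. \<bar>0 - y\<bar> < 1 \<longrightarrow> Re (F (complex_of_real 1 * cis y)) \<le> Re (F (complex_of_real 1 * cis 0))"
      using Fle[of "cis _"] \<open>F 1 = 1\<close> by (auto intro: order_trans[OF complex_Re_le_cmod])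
  qed simp
  then have "Im D = 0" by simp
  \<comment> \<open>Otherwise \<open>Re (F s) - s\<close>, which vanishes at \<open>s = 1\<close>,
    would be positive just to the left of \<open>1\<close>, against the Schwarz bound.\<close>
  have "\<not> Re D < 1"
  proof
    assume *: "Re D < 1"
    have "(of_real has_vector_derivative (1::complex)) (at (1::real))"
      by (auto intro!: derivative_eq_intros)
    from has_real_derivative_Re_path[OF _ this, of F D]
    have "((\<lambda>s. Re (F (of_real s))) has_real_derivative Re D) (at 1)"
      using F1 by simp
    from DERIV_neg_dec_left[OF DERIV_diff[OF this DERIV_ident]] * obtain d where "d > 0"
      and d: "\<And>h. h > 0 \<Longrightarrow> h < d \<Longrightarrow> 0 < Re (F (of_real (1 - h))) - (1 - h)"
      using \<open>F 1 = 1\<close> by auto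
    define h where "h = min (d/2) (1/2)"
    have h: "0 < h" "h < d" "h < 1" using \<open>d > 0\<close> by (auto simp: h_def)
    have "norm (complex_of_real (1 - h)) = 1 - h"
      using h by (simp only: norm_of_real)
    then have "Re (F (of_real (1 - h))) \<le> 1 - h"
      using Schw[of "of_real (1 - h)"] h
      by (intro order_trans[OF complex_Re_le_cmod]) auto
    with d[of h] h show False by simp
  qed
  show ?thesis
  proof
    show "1 \<le> Re D" using \<open>\<not> Re D < 1\<close> by simp
    have "D = of_real (Re D)" using \<open>Im D = 0\<close> by (simp add: complex_eq_iff)
    then show "z0 * deriv \<omega> z0 = of_real (Re D) * \<omega> z0"
      using nz by (simp add: D_def field_simps)
  qed
qed

section \<open>Convexity of the image and monotonicity of the normal field\<close>

locale convex_map =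
  fixes q :: "complex \<Rightarrow> complex"
  assumes univalent_q: "univalent q"
    and convexity: "\<And>z. z \<in> unit_disc \<Longrightarrow> 0 < Re (1 + z * deriv (deriv q) z / deriv q z)"
begin

lemma holo_q: "q holomorphic_on unit_disc" and inj_q: "inj_on q unit_disc"
  using univalent_q by (auto simp: univalent_def)

lemma deriv_q_nonzero: "z \<in> unit_disc \<Longrightarrow> deriv q z \<noteq> 0"
  by (rule holomorphic_injective_imp_regular[OF holo_q open_ball inj_q])

lemma holo_deriv_q: "deriv q holomorphic_on unit_disc"
  by (intro holomorphic_deriv holo_q open_ball)

text \<open>On the circle through \<open>\<zeta>\<close>, the outward normal \<open>z q' z\<close> has the argument
  \<open>t + Im (g z)\<close>, where \<open>q' = exp g\<close>, and the convexity condition says that this argument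
  increases. Over one period it grows by \<open>2 \<pi>\<close>, so the component of \<open>q\<close> in the normal direction
  at \<open>\<zeta>\<close> first decreases and then increases along the circle.\<close>
lemma support_halfplane:
  assumes "norm \<zeta> < 1" "norm z \<le> norm \<zeta>"
  shows "0 \<le> Re ((q \<zeta> - q z) * cnj (\<zeta> * deriv q \<zeta>))"
proof (cases "\<zeta> = 0")
  case False
  define r where "r = norm \<zeta>"
  define t0 where "t0 = Arg \<zeta>"
  have r: "0 < r" "r < 1" using False assms by (auto simp: r_def)
  have z0: "\<zeta> = of_real r * cis t0"
    using Arg_eq[OF False] by (simp only: r_def t0_def cis_conv_exp)
  obtain g where holg: "g holomorphic_on unit_disc"
    and g: "\<And>z. z \<in> unit_disc \<Longrightarrow> deriv q z = exp (g z)"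
    by (rule contractible_imp_holomorphic_log[OF holo_deriv_q])
      (use deriv_q_nonzero in \<open>auto intro!: convex_imp_contractible\<close>)
  define c where "c t = of_real r * cis t" for t
  have cin: "c t \<in> unit_disc" for t using r by (simp add: c_def norm_mult)
  have c': "(c has_vector_derivative \<i> * c t) (at t)" for t
    unfolding c_def using circle_path_has_vector_derivative .
  define \<psi> where "\<psi> t = t + Im (g (c t))" for t
  have nor: "c t * deriv q (c t) = of_real (r * exp (Re (g (c t)))) * cis (\<psi> t)" for t
  proof -
    have "deriv q (c t) = of_real (exp (Re (g (c t)))) * cis (Im (g (c t)))"
      using g[OF cin] by (simp add: exp_eq_polar)
    then show ?thesis by (simp add: \<psi>_def c_def cis_mult[symmetric] mult_ac)
  qed
  have dg: "deriv g z = deriv (deriv q) z / deriv q z" if "z \<in> unit_disc" for z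
  proof -
    have "deriv (deriv q) z = deriv (\<lambda>z. exp (g z)) z"
      by (rule complex_derivative_transform_within_open[OF holo_deriv_q _ open_ball that])
        (auto intro!: holomorphic_intros holg g)
    also have "\<dots> = exp (g z) * deriv g z"
      by (rule DERIV_imp_deriv)
        (auto intro!: derivative_eq_intros holomorphic_derivI[OF holg open_ball that])
    finally show ?thesis by (simp add: g[OF that])
  qed
  have \<psi>': "(\<psi> has_real_derivative Re (1 + c t * deriv (deriv q) (c t) / deriv q (c t))) (at t)" for t
  proof -
    have "((\<lambda>s. Re (- \<i> * g (c s))) has_real_derivative Re (\<i> * c t * (- \<i> * deriv g (c t)))) (at t)"
      by (rule has_real_derivative_Re_path[OF _ c'])
        (intro DERIV_cmult holomorphic_derivI[OF holg open_ball cin])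
    from DERIV_add[OF DERIV_ident this]
    have "(\<psi> has_real_derivative 1 + Re (\<i> * c t * (- \<i> * deriv g (c t)))) (at t)"
      by (simp add: \<psi>_def[abs_def])
    then show ?thesis using dg[OF cin] by (simp add: algebra_simps)
  qed
  have mono: "\<psi> s \<le> \<psi> t" if "s \<le> t" for s t
    by (rule DERIV_nonneg_imp_nondecreasing[OF that]) (use \<psi>' convexity[OF cin] in \<open>auto intro: less_imp_le\<close>)
  have per: "c (t + 2 * pi) = c t" for t by (simp add: c_def cis_mult[symmetric])
  have \<psi>per: "\<psi> (t + 2 * pi) = \<psi> t + 2 * pi" for t by (simp add: \<psi>_def per)
  \<comment> \<open>The component of the boundary curve along the unit normal at
    \<open>\<zeta>\<close>; its derivative has the sign of
    \<open>- sin (\<psi> t - \<psi> t0)\<close>.\<close>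
  define u where "u t = Re (cis (- \<psi> t0) * q (c t))" for t
  have u': "(u has_real_derivative - (r * exp (Re (g (c t))) * sin (\<psi> t - \<psi> t0))) (at t)" for t
  proof -
    have "(u has_real_derivative Re (\<i> * c t * (cis (- \<psi> t0) * deriv q (c t)))) (at t)"
      unfolding u_def
      by (rule has_real_derivative_Re_path[OF _ c'])
        (intro DERIV_cmult holomorphic_derivI[OF holo_q open_ball cin])
    also have "\<i> * c t * (cis (- \<psi> t0) * deriv q (c t))
        = \<i> * cis (- \<psi> t0) * (c t * deriv q (c t))" by simp
    also have "\<dots> = of_real (r * exp (Re (g (c t)))) * (\<i> * cis (\<psi> t - \<psi> t0))"
      unfolding nor by (simp add: cis_mult mult_ac)
    finally show ?thesis by simp
  qed
  have ule: "u t \<le> u t0" if "t0 \<le> t" "t \<le> t0 + 2 * pi" for t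
  \<comment> \<open>While the normal has turned by at most \<open>pi\<close>, \<open>u\<close> has
    not increased since \<open>t0\<close>. Afterwards it does not decrease until the period closes
    at the value \<open>u t0\<close>.\<close>
  proof (cases "\<psi> t - \<psi> t0 \<le> pi")
    case True
    show ?thesis
    proof (rule DERIV_nonpos_imp_nonincreasing[OF that(1)])
      fix x assume "t0 \<le> x" "x \<le> t"
      then have "0 \<le> sin (\<psi> x - \<psi> t0)"
        using True mono[of t0 x] mono[of x t] by (intro sin_ge_zero) auto
      then show "\<exists>y. (u has_real_derivative y) (at x) \<and> y \<le> 0"
        using u'[of x] r by (intro exI conjI) auto
    qed
  next
    case False
    have "u t \<le> u (t0 + 2 * pi)"
    proof (rule DERIV_nonneg_imp_nondecreasing[OF that(2)])
      fix x assume x: "t \<le> x" "x \<le> t0 + 2 * pi"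
      have "0 \<le> sin (\<psi> x - \<psi> t0 - pi)"
        using False mono[OF x(1)] mono[OF x(2)] \<psi>per[of t0] by (intro sin_ge_zero) auto
      then have "sin (\<psi> x - \<psi> t0) \<le> 0" by (simp add: sin_diff)
      then show "\<exists>y. (u has_real_derivative y) (at x) \<and> 0 \<le> y"
        using u'[of x] r by (intro exI conjI) (auto simp: mult_nonneg_nonpos)
    qed
    then show ?thesis by (simp add: u_def per)
  qed
  have "Re (cis (- \<psi> t0) * q z) \<le> u t0"
  proof (rule maximum_real_frontier[where S = "cball 0 r" and f = "\<lambda>z. cis (- \<psi> t0) * q z"])
    have sub: "cball 0 r \<subseteq> unit_disc" using r by auto
    show "(\<lambda>z. cis (- \<psi> t0) * q z) holomorphic_on interior (cball 0 r)"
      using sub by (intro holomorphic_intros holomorphic_on_subset[OF holo_q]) auto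
    show "continuous_on (closure (cball 0 r)) (\<lambda>z. cis (- \<psi> t0) * q z)"
      using sub by (intro continuous_intros continuous_on_subset[OF holomorphic_on_imp_continuous_on[OF holo_q]]) auto
    show "z \<in> cball 0 r" using assms by (simp add: r_def)
    fix w :: complex assume "w \<in> frontier (cball 0 r)"
    then have nw: "norm w = r" by simp
    then have "w \<noteq> 0" using r by auto
    have "c (Arg w) = w"
      using Arg_eq[OF \<open>w \<noteq> 0\<close>] by (simp only: c_def cis_conv_exp nw)
    then have w: "Re (cis (- \<psi> t0) * q w) = u (Arg w)" by (simp add: u_def)
    have uper: "u (t + 2 * pi) = u t" for t by (simp add: u_def per)
    show "Re (cis (- \<psi> t0) * q w) \<le> u t0"
    \<comment> \<open>Both arguments lie between \<open>- pi\<close> and \<open>pi\<close>, so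
      \<open>Arg w\<close> or \<open>Arg w + 2 * pi\<close> falls into the period starting at
      \<open>t0\<close>.\<close>
    proof (cases "t0 \<le> Arg w")
      case True
      then show ?thesis
        using ule[of "Arg w"] Arg_bounded[of w] Arg_bounded[of \<zeta>] w by (simp add: t0_def)
    next
      case False
      then show ?thesis
        using ule[of "Arg w + 2 * pi"] Arg_bounded[of w] Arg_bounded[of \<zeta>] w
        by (simp add: t0_def uper)
    qed
  qed simp
  then have "0 \<le> Re ((q \<zeta> - q z) * cis (- \<psi> t0))"
    by (simp add: u_def z0 c_def algebra_simps)
  then have "0 \<le> r * exp (Re (g (c t0))) * Re ((q \<zeta> - q z) * cis (- \<psi> t0))"
    using r by simp
  also have "\<dots> = Re (of_real (r * exp (Re (g (c t0)))) * ((q \<zeta> - q z) * cis (- \<psi> t0)))"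
    by simp
  also have "\<dots> = Re ((q \<zeta> - q z) * cnj (\<zeta> * deriv q \<zeta>))"
  proof -
    have "cnj (\<zeta> * deriv q \<zeta>) = of_real (r * exp (Re (g (c t0)))) * cis (- \<psi> t0)"
      unfolding z0[folded c_def] nor by (simp add: cis_cnj)
    then show ?thesis by (simp only: mult_ac)
  qed
  finally show ?thesis .
qed (use assms in simp)

lemma open_image:
  assumes "S \<subseteq> unit_disc" "open S"
  shows "open (q ` S)"
  using assms holomorphic_on_subset[OF holo_q] inj_on_subset[OF inj_q] by (intro open_mapping_thm3) auto

text \<open>As \<open>r < 1\<close>, the closed ball is compact inside the disc. Frontier points of
  the image thus come from the circle, where a supporting half-plane is available.\<close>

lemma closure_image_ball:
  assumes "r < 1"
  shows "closure (q ` ball 0 r) \<subseteq> q ` cball 0 r"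
proof (rule closure_minimal)
  have "continuous_on (cball 0 r) q"
    using assms by (intro holomorphic_on_imp_continuous_on holomorphic_on_subset[OF holo_q]) auto
  then show "closed (q ` cball 0 r)"
    by (intro compact_imp_closed compact_continuous_image) auto
qed auto

text \<open>A segment leaving \<open>q ` ball 0 r\<close> would do so at a boundary point, where the supporting
  half-plane puts both end points on its edge; but the end points are interior.\<close>
lemma convex_image_ball:
  assumes "r < 1"
  shows "convex (q ` ball 0 r)"
proof (rule ccontr)
  let ?U = "q ` ball 0 r"
  have opn: "open ?U" using assms by (intro open_image) auto
  assume "\<not> convex ?U"
  then obtain a b c where ab: "a \<in> ?U" "b \<in> ?U" "c \<in> closed_segment a b" "c \<notin> ?U"
    unfolding convex_contains_segment by blast
  have "closed_segment a b \<inter> frontier ?U \<noteq> {}"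
    by (rule connected_Int_frontier) (use ab in auto)
  then obtain x where x: "x \<in> closed_segment a b" "x \<in> frontier ?U" by auto
  then have "x \<notin> ?U" "x \<in> q ` cball 0 r"
    using opn closure_image_ball[OF assms] by (auto simp: frontier_def interior_open)
  then obtain \<zeta> where \<zeta>: "x = q \<zeta>" "norm \<zeta> = r" by (force simp: less_le)
  have "0 < r" using ab by (auto simp: not_less) (metis ball_eq_empty empty_iff mem_ball_0 not_less)
  define k where "k = \<zeta> * deriv q \<zeta>"
  have "\<zeta> \<noteq> 0" using \<zeta> \<open>0 < r\<close> by auto
  then have k: "k \<noteq> 0" using \<zeta> assms deriv_q_nonzero[of \<zeta>] by (simp add: k_def)
  have supp: "0 \<le> Re ((x - y) * cnj k)" if "y \<in> ?U" for y
    using that support_halfplane[of \<zeta>] \<zeta> assms by (auto simp: k_def)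
  have strict: "0 < Re ((x - y) * cnj k)" if y: "y \<in> ?U" for y
  proof -
    obtain e where e: "0 < e" "cball y e \<subseteq> ?U"
      using opn y unfolding open_contains_cball by blast
    \<comment> \<open>A shift of length \<open>e\<close> along the outward normal: the weak
      inequality at \<open>y + d\<close> leaves a surplus of \<open>e * norm k\<close> at
      \<open>y\<close>.\<close>
    define d where "d = of_real (e / norm k) * k"
    have "norm d = e" using e k by (simp add: d_def norm_mult norm_divide)
    then have "y + d \<in> ?U" using e by (auto simp: dist_norm)
    then have "0 \<le> Re ((x - y) * cnj k) - Re (d * cnj k)"
      using supp[of "y + d"] by (simp add: algebra_simps)
    moreover have "Re (d * cnj k) = e * norm k"
    proof -
      have "d * cnj k = of_real (e / norm k * (norm k)\<^sup>2)"
        unfolding d_def of_real_mult complex_norm_square by simp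
      then show ?thesis by (simp add: power2_eq_square)
    qed
    ultimately show ?thesis using e k by (smt (verit) mult_pos_pos zero_less_norm_iff)
  qed
  obtain t where t: "0 \<le> t" "t \<le> 1" "x = (1 - t) *\<^sub>R a + t *\<^sub>R b"
    using x by (auto simp: closed_segment_def)
  \<comment> \<open>As \<open>x\<close> lies on the segment, the weighted signed distances of the
    end points from the supporting line at \<open>x\<close> must cancel.\<close>
  have "(1 - t) * Re ((x - a) * cnj k) + t * Re ((x - b) * cnj k)
      = Re (((1 - t) *\<^sub>R (x - a) + t *\<^sub>R (x - b)) * cnj k)"
    by (simp add: algebra_simps)
  also have "(1 - t) *\<^sub>R (x - a) + t *\<^sub>R (x - b) = x - ((1 - t) *\<^sub>R a + t *\<^sub>R b)"
    by (simp add: algebra_simps)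
  also have "\<dots> = 0" using t by simp
  finally have "(1 - t) * Re ((x - a) * cnj k) + t * Re ((x - b) * cnj k) = 0" by simp
  moreover have "0 < (1 - t) * Re ((x - a) * cnj k) + t * Re ((x - b) * cnj k)"
  proof (cases "t = 0")
    case True
    then show ?thesis using strict[OF ab(1)] by simp
  next
    case False
    then show ?thesis
      using t strict[OF ab(1)] strict[OF ab(2)] by (intro add_nonneg_pos mult_nonneg_nonneg mult_pos_pos) auto
  qed
  ultimately show False by simp
qed

text \<open>\<open>q\<close> need not extend to the unit circle, hence the detour through smaller
  balls; any two points of the image come from a common one.\<close>

lemma convex_image_disc: "convex (q ` unit_disc)"
  unfolding convex_contains_segment
proof (intro ballI)
  fix a b assume "a \<in> q ` unit_disc" "b \<in> q ` unit_disc"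
  then obtain z w where zw: "a = q z" "b = q w" "norm z < 1" "norm w < 1" by auto
  then obtain r where r: "max (norm z) (norm w) < r" "r < 1"
    using dense[of "max (norm z) (norm w)" 1] by auto
  then have "closed_segment a b \<subseteq> q ` ball 0 r"
    using zw convex_image_ball[OF r(2)] by (auto simp: convex_contains_segment)
  then show "closed_segment a b \<subseteq> q ` unit_disc" using r by force
qed

text \<open>As a function of \<open>q z\<close>, the field \<open>z q' z\<close> has derivative \<open>1 + z q'' z / q' z\<close>; integrate
  it along the segment from \<open>q z\<close> to \<open>q w\<close>.\<close>
lemma normal_monotone:
  assumes c: "\<And>z. z \<in> unit_disc \<Longrightarrow> c < Re (1 + z * deriv (deriv q) z / deriv q z)"
    and zw: "z \<in> unit_disc" "w \<in> unit_disc" "q w \<noteq> q z"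
  shows "c * (norm (q w - q z))\<^sup>2 < Re ((w * deriv q w - z * deriv q z) * cnj (q w - q z))"
proof -
  obtain g where holg: "g holomorphic_on (q ` unit_disc)"
    and g': "\<And>z. z \<in> unit_disc \<Longrightarrow> deriv q z * deriv g (q z) = 1"
    and g: "\<And>z. z \<in> unit_disc \<Longrightarrow> g (q z) = z"
    using holomorphic_has_inverse[OF holo_q open_ball inj_q] by blast
  define v where "v = q w - q z"
  define k where "k x = g x * deriv q (g x)" for x
  define x where "x s = q z + of_real s * v" for s :: real
  have k': "(k has_field_derivative 1 + z * deriv (deriv q) z / deriv q z) (at (q z))"
    if "z \<in> unit_disc" for z
  proof -
    have dg: "(g has_field_derivative 1 / deriv q z) (at (q z))"
    proof -
      have "deriv g (q z) = 1 / deriv q z"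
        using g'[OF that] deriv_q_nonzero[OF that] by (simp add: field_simps)
      then show ?thesis
        using holomorphic_derivI[OF holg open_image[OF order_refl open_ball], of "q z"] that by auto
    qed
    have "(deriv q has_field_derivative deriv (deriv q) z) (at (g (q z)))"
      unfolding g[OF that] by (rule holomorphic_derivI[OF holo_deriv_q open_ball that])
    from DERIV_mult[OF dg DERIV_chain2[OF this dg]] show ?thesis
      using that g[OF that] deriv_q_nonzero[OF that] by (simp add: k_def[abs_def] field_simps)
  qed
  \<comment> \<open>Convexity keeps the segment in the image. Its velocity is \<open>v\<close> and
    \<open>v * cnj v\<close> is real, so only the real part of the derivative of \<open>k\<close>
    survives.\<close>
  have "\<exists>D. ((\<lambda>s. Re (cnj v * k (x s))) has_real_derivative D * (norm v)\<^sup>2) (at s) \<and> c < D"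
    if s: "0 \<le> s" "s \<le> 1" for s
  proof -
    have "x s = (1 - s) *\<^sub>R q z + s *\<^sub>R q w"
      by (simp add: x_def v_def scaleR_conv_of_real algebra_simps)
    then have "x s \<in> q ` unit_disc"
      using convexD_alt[OF convex_image_disc, of "q z" "q w" s] zw s by auto
    then obtain y where y: "y \<in> unit_disc" "x s = q y" by auto
    define D where "D = 1 + y * deriv (deriv q) y / deriv q y"
    have "(x has_vector_derivative v) (at s)"
      unfolding x_def by (auto intro!: derivative_eq_intros)
    from has_field_derivative_Re[OF field_vector_diff_chain_at[OF this, of "\<lambda>y. cnj v * k y" "cnj v * D"]]
    have "((\<lambda>s. Re (cnj v * k (x s))) has_real_derivative Re (v * (cnj v * D))) (at s)"
      using DERIV_cmult[OF k'[OF y(1)]] by (simp add: y(2) D_def o_def)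
    also have "Re (v * (cnj v * D)) = Re D * (norm v)\<^sup>2"
    proof -
      have "Re (v * (cnj v * D)) = ((Re v)\<^sup>2 + (Im v)\<^sup>2) * Re D"
        by (simp add: power2_eq_square algebra_simps)
      then show ?thesis by (simp only: cmod_power2 mult.commute)
    qed
    finally show ?thesis using c[OF y(1)] by (auto simp: D_def)
  qed
  then obtain D where D: "\<And>s. 0 \<le> s \<Longrightarrow> s \<le> 1 \<Longrightarrow>
      ((\<lambda>s. Re (cnj v * k (x s))) has_real_derivative D s * (norm v)\<^sup>2) (at s) \<and> c < D s"
    by metis
  \<comment> \<open>The mean value theorem takes the place of integration and keeps the inequality
    strict.\<close>
  obtain s where s: "0 < s" "s < 1"
    "Re (cnj v * k (x 1)) - Re (cnj v * k (x 0)) = (1 - 0) * (D s * (norm v)\<^sup>2)"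
    using MVT2[of 0 1 "\<lambda>s. Re (cnj v * k (x s))" "\<lambda>s. D s * (norm v)\<^sup>2"] D by auto
  have kx: "k (x 1) = w * deriv q w" "k (x 0) = z * deriv q z"
    using zw by (simp_all add: k_def x_def v_def g)
  have "v \<noteq> 0" using zw by (simp add: v_def)
  then have "c * (norm v)\<^sup>2 < D s * (norm v)\<^sup>2" using D[of s] s by simp
  also have "\<dots> = Re ((w * deriv q w - z * deriv q z) * cnj v)"
    using s(3) by (simp add: kx algebra_simps)
  finally show ?thesis by (simp add: v_def)
qed

section \<open>First-contact argument for the differential subordination\<close>

lemma differential_subordination:
  assumes "\<gamma> \<noteq> 0"
    and cond: "\<And>z. z \<in> unit_disc \<Longrightarrow> - Re (1 / \<gamma>) < Re (1 + z * deriv (deriv q) z / deriv q z)"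
    and hol\<Phi>: "\<Phi> holomorphic_on unit_disc"
    and sub: "(\<lambda>z. \<Phi> z + \<gamma> * (z * deriv \<Phi> z)) \<prec> (\<lambda>z. q z + \<gamma> * (z * deriv q z))"
  shows "\<Phi> \<prec> q"
proof -
  obtain w where holw: "w holomorphic_on unit_disc" and [simp]: "w 0 = 0"
    and w1: "\<And>z. norm z < 1 \<Longrightarrow> norm (w z) < 1"
    and w: "\<And>z. norm z < 1 \<Longrightarrow>
      \<Phi> z + \<gamma> * (z * deriv \<Phi> z) = q (w z) + \<gamma> * (w z * deriv q (w z))"
    using sub unfolding subordinate_def Ball_def mem_ball_0 by blast
  have \<Phi>0: "\<Phi> 0 = q 0" using w[of 0] by simp
  have cont: "continuous_on unit_disc \<Phi>" by (rule holomorphic_on_imp_continuous_on[OF hol\<Phi>])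
  obtain g where holg: "g holomorphic_on (q ` unit_disc)"
    and g: "\<And>z. z \<in> unit_disc \<Longrightarrow> g (q z) = z"
    using holomorphic_has_inverse[OF holo_q open_ball inj_q] by metis
  \<comment> \<open>The gap between \<open>r\<close> and \<open>\<rho>\<close> separates the two
    points compared below: \<open>norm (w z0) \<le> r\<close> by Schwarz, but
    \<open>norm \<zeta> = \<rho>\<close>.\<close>
  have step: "\<Phi> z \<in> q ` ball 0 \<rho>" if z: "norm z \<le> r" and r: "r < \<rho>" "\<rho> < 1" for z r \<rho>
  proof (rule ccontr)
    let ?U = "q ` ball 0 \<rho>"
    assume z': "\<Phi> z \<notin> ?U"
    have opn: "open ?U" using r by (intro open_image) auto
    \<comment> \<open>A point of least modulus in this compact set is the first contact: points of
      smaller modulus still map into the open image.\<close>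
    define B where "B = cball 0 r \<inter> \<Phi> -` (- ?U)"
    have "closed B"
      unfolding B_def using opn r
      by (intro continuous_closed_preimage continuous_on_subset[OF cont]) auto
    then have "compact B" by (auto simp: compact_eq_bounded_closed B_def)
    moreover have "z \<in> B" using z z' by (simp add: B_def)
    ultimately obtain z0 where z0: "z0 \<in> B" "\<And>y. y \<in> B \<Longrightarrow> norm z0 \<le> norm y"
      using continuous_attains_inf[of B norm] by (auto intro: continuous_intros)
    have \<rho>: "0 < \<rho>" using norm_ge_zero[of z] z r by linarith
    have z0r: "norm z0 \<le> r" "\<Phi> z0 \<notin> ?U" using z0(1) by (auto simp: B_def)
    have inU: "\<Phi> y \<in> ?U" if "norm y < norm z0" for y
      using that z0(2)[of y] z0r by (force simp: B_def)
    have "z0 \<noteq> 0" using z0r \<Phi>0 \<rho> by auto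
    have incl: "\<Phi> y \<in> q ` cball 0 \<rho>" if y: "norm y \<le> norm z0" for y
    proof -
      have "\<Phi> ` closure (ball 0 (norm z0)) \<subseteq> closure ?U"
      proof (rule image_closure_subset)
        show "continuous_on (closure (ball 0 (norm z0))) \<Phi>"
          using z0r r \<open>z0 \<noteq> 0\<close> by (intro continuous_on_subset[OF cont]) auto
        show "\<Phi> ` ball 0 (norm z0) \<subseteq> closure ?U"
          using inU closure_subset by fastforce
      qed simp
      then show ?thesis using y \<open>z0 \<noteq> 0\<close> closure_image_ball[OF r(2)] by (simp add: image_subset_iff subset_iff)
    qed
    obtain \<zeta> where \<zeta>: "\<Phi> z0 = q \<zeta>" "norm \<zeta> \<le> \<rho>" using incl[of z0] by auto
    then have n\<zeta>: "norm \<zeta> = \<rho>" using z0r by (force simp: less_le)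
    \<comment> \<open>\<open>\<Phi>\<close> is not yet known to stay in the range of
      \<open>q\<close>, so \<open>q\<close> is inverted only on this open set. It contains the
      closed disc through \<open>z0\<close>, as Jack's lemma requires.\<close>
    define S where "S = unit_disc \<inter> \<Phi> -` (q ` unit_disc)"
    define \<omega> where "\<omega> = (\<lambda>z. g (\<Phi> z))"
    have opS: "open S"
      unfolding S_def by (intro continuous_open_preimage cont open_ball open_image order_refl)
    have hol\<omega>: "\<omega> holomorphic_on S"
      unfolding \<omega>_def
      by (rule holomorphic_on_compose_gen[OF _ holg, unfolded o_def])
        (auto simp: S_def intro: holomorphic_on_subset[OF hol\<Phi>])
    have cbS: "cball 0 (norm z0) \<subseteq> S"
    proof
      fix y :: complex assume "y \<in> cball 0 (norm z0)"
      then have "norm y \<le> norm z0" by simp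
      with incl[OF this] z0r r show "y \<in> S" by (auto simp: S_def)
    qed
    have \<omega>z0: "\<omega> z0 = \<zeta>" using \<zeta> r g[of \<zeta>] by (simp add: \<omega>_def)
    have "norm (\<omega> y) < norm (\<omega> z0)" if "norm y < norm z0" for y
      using inU[OF that] g r unfolding \<omega>z0 n\<zeta> by (auto simp: \<omega>_def)
    moreover have "\<omega> 0 = 0" using g[of 0] by (simp add: \<omega>_def \<Phi>0)
    ultimately obtain m :: real where m: "1 \<le> m" "z0 * deriv \<omega> z0 = of_real m * \<zeta>"
      using Jack_lemma[OF hol\<omega> opS cbS] \<open>z0 \<noteq> 0\<close> \<omega>z0 by metis
    have "z0 \<in> S" using cbS by auto
    have d\<Phi>: "deriv \<Phi> z0 = deriv q \<zeta> * deriv \<omega> z0"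
    proof (rule DERIV_imp_deriv)
      have "((\<lambda>z. q (\<omega> z)) has_field_derivative deriv q \<zeta> * deriv \<omega> z0) (at z0)"
        using \<zeta> r holomorphic_derivI[OF holo_q open_ball, of \<zeta>]
          holomorphic_derivI[OF hol\<omega> opS \<open>z0 \<in> S\<close>] by (intro DERIV_chain2[where f = q]) (auto simp: \<omega>z0)
      moreover have "q (\<omega> y) = \<Phi> y" if "y \<in> S" for y
        using that g by (auto simp: S_def \<omega>_def)
      ultimately show "(\<Phi> has_field_derivative deriv q \<zeta> * deriv \<omega> z0) (at z0)"
        by (rule has_field_derivative_transform_within_open[OF _ opS \<open>z0 \<in> S\<close>])
    qed
    define v where "v = w z0"
    define k where "k z = z * deriv q z" for z
    have "norm v \<le> norm z0"
      unfolding v_def using w1 z0r r by (intro Schwarz_Lemma(1) holw) auto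
    then have nv: "norm v < norm \<zeta>" using z0r r n\<zeta> by simp
    have v\<zeta>: "v \<in> unit_disc" "\<zeta> \<in> unit_disc" using nv n\<zeta> r by auto
    moreover have "\<zeta> \<noteq> v" using nv by auto
    ultimately have "q \<zeta> \<noteq> q v" using inj_onD[OF inj_q] by blast
    have Re_mult_of_real: "Re (of_real x * y) = x * Re y" for x y by simp
    define d where "d = q \<zeta> - q v"
    have "z0 * deriv \<Phi> z0 = of_real m * k \<zeta>"
      using m(2) by (simp add: d\<Phi> k_def mult.left_commute)
    then have "q \<zeta> + \<gamma> * (of_real m * k \<zeta>) = q v + \<gamma> * k v"
      using w[of z0] z0r r by (simp add: \<zeta> v_def k_def)
    then have "k \<zeta> - k v = - (of_real (m - 1) * k \<zeta>) - 1 / \<gamma> * d"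
      using \<open>\<gamma> \<noteq> 0\<close> by (simp add: d_def field_simps)
    then have "(k \<zeta> - k v) * cnj d = (- (of_real (m - 1) * k \<zeta>) - 1 / \<gamma> * d) * cnj d"
      by (simp only:)
    also have "\<dots> = - (of_real (m - 1) * (k \<zeta> * cnj d)) - 1 / \<gamma> * (d * cnj d)"
      by (simp add: algebra_simps)
    also have "\<dots> = - (of_real (m - 1) * (k \<zeta> * cnj d)) - of_real ((norm d)\<^sup>2) * (1 / \<gamma>)"
      unfolding complex_norm_square by (simp only: mult.commute)
    finally have "Re ((k \<zeta> - k v) * cnj d)
        = - ((m - 1) * Re (k \<zeta> * cnj d)) - (norm d)\<^sup>2 * Re (1 / \<gamma>)"
      by (simp only: minus_complex.sel uminus_complex.sel Re_mult_of_real)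
    moreover have "0 \<le> (m - 1) * Re (k \<zeta> * cnj d)"
    proof -
      have "Re (k \<zeta> * cnj d) = Re (d * cnj (k \<zeta>))" by (simp add: mult.commute)
      also have "\<dots> \<ge> 0"
        unfolding d_def k_def using v\<zeta> nv by (intro support_halfplane) auto
      finally show ?thesis using m(1) by (intro mult_nonneg_nonneg) auto
    qed
    \<comment> \<open>With the constant \<open>- Re (1 / \<gamma>)\<close>, monotonicity strictly
      contradicts the identity above once its term in \<open>m - 1\<close> is estimated.\<close>
    moreover have "- Re (1 / \<gamma>) * (norm d)\<^sup>2 < Re ((k \<zeta> - k v) * cnj d)"
      unfolding d_def k_def by (rule normal_monotone) (use cond v\<zeta> \<open>q \<zeta> \<noteq> q v\<close> in auto)
    ultimately show False by (simp add: mult.commute)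
  qed
  have img: "\<Phi> z \<in> q ` unit_disc" if z: "norm z < 1" for z
  proof -
    obtain \<rho> where "norm z < \<rho>" "\<rho> < 1" using dense[OF z] by auto
    then have "\<Phi> z \<in> q ` ball 0 \<rho>" by (intro step[of z "norm z"]) auto
    then show ?thesis using \<open>\<rho> < 1\<close> by force
  qed
  show ?thesis
    unfolding subordinate_def
  proof (intro conjI exI[of _ "\<lambda>z. g (\<Phi> z)"] ballI)
    show "(\<lambda>z. g (\<Phi> z)) holomorphic_on unit_disc"
      by (rule holomorphic_on_compose_gen[OF hol\<Phi> holg, unfolded o_def]) (use img in auto)
    show "g (\<Phi> 0) = 0" using g[of 0] by (simp add: \<Phi>0)
    fix z assume z: "z \<in> unit_disc"
    then obtain y where "y \<in> unit_disc" "\<Phi> z = q y" using img[of z] by auto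
    then show "norm (g (\<Phi> z)) < 1" "\<Phi> z = q (g (\<Phi> z))" using g by auto
  qed (fact hol\<Phi> holo_q)+
qed

end

section \<open>Zeros of \<open>f\<close> and powers of the quotient\<close>

lemma class_A_factorization:
  assumes "p \<ge> 1" "n \<ge> 1" "f \<in> class_A p n"
  obtains F where "F holomorphic_on unit_disc" "F 0 = 1"
    "\<And>z. z \<in> unit_disc \<Longrightarrow> F z \<noteq> 0" "\<And>z. z \<in> unit_disc \<Longrightarrow> f z = z ^ p * F z"
proof -
  from assms(3) obtain a where pv: "p_valent p f"
    and a: "\<And>z. norm z < 1 \<Longrightarrow> (\<lambda>k. a (n + k + p) * z ^ (n + k + p)) sums (f z - z ^ p)"
    unfolding class_A_def mem_Collect_eq Ball_def mem_ball_0 by blast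
  have holf: "f holomorphic_on unit_disc" and fin: "finite (fibre f 0)" and val: "valence f 0 \<le> p"
    using pv unfolding p_valent_def by auto
  \<comment> \<open>The coefficients of \<open>f z / z ^ p\<close>; \<open>n \<ge> 1\<close> keeps
    the constant term apart from the others.\<close>
  define b where "b j = (if n \<le> j then a (j + p) else if j = 0 then 1 else 0)" for j
  define F where "F z = (if z = 0 then 1 else f z / z ^ p)" for z
  have "(\<lambda>j. b j * z ^ j) sums F z" if z: "norm z < 1" for z
  proof -
    have "(\<lambda>k. if n \<le> k then a (k + p) * z ^ k else 0) sums (F z - 1)"
    proof (cases "z = 0")
      case True
      then have "(\<lambda>k. if n \<le> k then a (k + p) * z ^ k else 0) = (\<lambda>k. 0)"
        using \<open>n \<ge> 1\<close> by auto
      then show ?thesis using True by (simp add: F_def)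
    next
      case False
      have "(\<lambda>k. a (n + k + p) * z ^ (n + k + p) / z ^ p) sums ((f z - z ^ p) / z ^ p)"
        by (rule sums_divide[OF a[OF z]])
      then have "(\<lambda>k. a (n + k + p) * z ^ (n + k)) sums (F z - 1)"
        using False by (simp add: F_def power_add diff_divide_distrib)
      then have "(\<lambda>k. (\<lambda>k. if n \<le> k then a (k + p) * z ^ k else 0) (k + n)) sums (F z - 1)"
        by (simp add: add.commute)
      then show ?thesis by (subst (asm) sums_zero_iff_shift) auto
    qed
    from sums_add[OF this sums_single[of 0 "\<lambda>_. 1"]]
    have "(\<lambda>k. (if n \<le> k then a (k + p) * z ^ k else 0) + (if k = 0 then 1 else 0)) sums F z"
      by simp
    also have "(\<lambda>k. (if n \<le> k then a (k + p) * z ^ k else 0) + (if k = 0 then 1 else 0))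
        = (\<lambda>j. b j * z ^ j)"
      using \<open>n \<ge> 1\<close> by (auto simp: b_def fun_eq_iff)
    finally show ?thesis .
  qed
  then have holF: "F holomorphic_on unit_disc"
    by (intro power_series_holomorphic[of 0 1 b]) auto
  have "(\<lambda>k. 0) sums f 0" using a[of 0] \<open>p \<ge> 1\<close> by (simp add: zero_power)
  then have f0: "f 0 = 0" by (rule sums_unique2[OF _ sums_zero])
  have F0: "F 0 = 1" by (simp add: F_def)
  have fF: "f z = z ^ p * F z" for z using f0 \<open>p \<ge> 1\<close> by (simp add: F_def)
  have z0: "zorder (\<lambda>u. f u - 0) 0 = int p"
    by (rule zorder_eqI[OF open_ball _ holF]) (simp_all add: fF F0)
  \<comment> \<open>The zero at the origin already has order \<open>p\<close>, so a further zero
    would push the valence of \<open>0\<close> above \<open>p\<close>.\<close>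
  have "f z \<noteq> 0" if z: "z \<in> unit_disc" "z \<noteq> 0" for z
  proof
    assume "f z = 0"
    \<comment> \<open>Finiteness of the fibre isolates the zero, so \<open>f\<close> is not locally
      constant there and the order is positive.\<close>
    have "\<forall>\<^sub>F u in at z. u \<notin> fibre f 0"
      using islimpt_finite[OF fin, of z] by (simp add: islimpt_iff_eventually)
    moreover have "\<forall>\<^sub>F u in at z. u \<in> unit_disc"
      using z by (intro eventually_at_in_open') auto
    ultimately have "\<forall>\<^sub>F u in at z. f u - 0 \<noteq> 0"
      by eventually_elim (auto simp: fibre_def)
    then have "\<exists>\<^sub>F u in at z. f u - 0 \<noteq> 0"
      by (rule eventually_frequently[rotated]) simp
    moreover have "(\<lambda>u. f u - 0) holomorphic_on unit_disc" using holf by simp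
    ultimately have "zorder (\<lambda>u. f u - 0) z > 0"
      using z \<open>f z = 0\<close> by (subst zorder_pos_iff[where A = unit_disc]) auto
    then have "p < (\<Sum>x\<in>{0, z}. nat (zorder (\<lambda>u. f u - 0) x))"
      using z z0 by simp
    also have "\<dots> \<le> valence f 0"
      unfolding valence_def using fin f0 \<open>f z = 0\<close> z
      by (intro sum_mono2) (auto simp: fibre_def)
    finally show False using val by simp
  qed
  then have "F z \<noteq> 0" if "z \<in> unit_disc" for z
    using that by (auto simp: F_def)
  then show thesis using that[OF holF F0] fF by blast
qed

text \<open>A logarithm of \<open>Q\<close> vanishing at \<open>0\<close> agrees with the principal one near \<open>0\<close>; by the identity
  theorem the two powers agree throughout, even where \<open>Q\<close> crosses the branch cut.\<close>
lemma deriv_powr_unit_disc: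
  assumes holQ: "Q holomorphic_on unit_disc" and "Q 0 = 1"
    and nz: "\<And>z. z \<in> unit_disc \<Longrightarrow> Q z \<noteq> 0"
    and holP: "(\<lambda>z. Q z powr c) holomorphic_on unit_disc"
    and z: "z \<in> unit_disc"
  shows "deriv (\<lambda>z. Q z powr c) z = c * (deriv Q z / Q z) * Q z powr c"
proof -
  obtain g0 where holg0: "g0 holomorphic_on unit_disc"
    and g0: "\<And>z. z \<in> unit_disc \<Longrightarrow> Q z = exp (g0 z)"
    by (rule contractible_imp_holomorphic_log[OF holQ])
      (use nz in \<open>auto intro!: convex_imp_contractible\<close>)
  define g where "g z = g0 z - g0 0" for z
  have holg: "g holomorphic_on unit_disc"
    unfolding g_def[abs_def] by (intro holomorphic_intros holg0)
  have Q: "Q z = exp (g z)" if "z \<in> unit_disc" for z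
    using g0[OF that] g0[of 0] \<open>Q 0 = 1\<close> by (simp add: g_def exp_diff)
  \<comment> \<open>Strict bounds on the imaginary part make the set open, and on it
    \<open>g\<close> is the principal logarithm of \<open>Q\<close>.\<close>
  define T where "T = unit_disc \<inter> g -` {z. - pi < Im z \<and> Im z < pi}"
  have opT: "open T"
    unfolding T_def
    by (intro continuous_open_preimage holomorphic_on_imp_continuous_on[OF holg] open_ball)
      (auto intro!: open_Collect_conj open_Collect_less continuous_intros)
  have eq: "Q z powr c = exp (c * g z)" if z: "z \<in> unit_disc" for z
  proof (rule analytic_continuation_open[OF opT open_ball _ _ _ holP _ _ z])
    have "0 \<in> T" by (simp add: T_def g_def)
    then show "T \<noteq> {}" by blast
    show "(\<lambda>z. exp (c * g z)) holomorphic_on unit_disc" by (intro holomorphic_intros holg)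
    show "Q z powr c = exp (c * g z)" if "z \<in> T" for z
      using that by (auto simp: T_def Q powr_def)
  qed (auto simp: T_def)
  have dQ: "deriv Q z = deriv g z * Q z"
  proof -
    have "deriv Q z = deriv (\<lambda>z. exp (g z)) z"
      by (rule complex_derivative_transform_within_open[OF holQ _ open_ball z])
        (auto intro!: holomorphic_intros holg Q)
    also have "\<dots> = exp (g z) * deriv g z"
      by (rule DERIV_imp_deriv)
        (auto intro!: derivative_eq_intros holomorphic_derivI[OF holg open_ball z])
    finally show ?thesis by (simp add: Q[OF z])
  qed
  have "deriv (\<lambda>z. Q z powr c) z = deriv (\<lambda>z. exp (c * g z)) z"
    by (rule complex_derivative_transform_within_open[OF holP _ open_ball z])
      (auto intro!: holomorphic_intros holg eq)
  also have "\<dots> = exp (c * g z) * (c * deriv g z)"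
    by (rule DERIV_imp_deriv)
      (auto intro!: derivative_eq_intros holomorphic_derivI[OF holg open_ball z])
  finally show ?thesis using nz[OF z] by (simp add: eq[OF z] dQ)
qed

text \<open>Formulas that agree only on the disc cannot be exchanged as functions; the holomorphy
  inside \<open>\<prec>\<close> has to be carried over as well.\<close>

lemma subordinate_cong:
  fixes F F' G :: "complex \<Rightarrow> complex"
  assumes "F \<prec> G" "\<And>z. z \<in> unit_disc \<Longrightarrow> F z = F' z"
  shows "F' \<prec> G"
proof -
  have "F' holomorphic_on unit_disc"
    by (rule holomorphic_transform[of F]) (use assms in \<open>auto simp: subordinate_def\<close>)
  then show ?thesis
    using assms unfolding subordinate_def by metis
qed

section \<open>From \<open>f\<close> to the differential subordination\<close>

theorem theorem3p1:
  fixes p n :: nat and q f :: "complex \<Rightarrow> complex" and \<mu> :: complex and \<alpha> \<beta> :: real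
  assumes "p \<ge> 1" and "n \<ge> 1"
    and "univalent q"
    and "\<mu> \<noteq> 0" and "\<alpha> \<ge> 0" and "Complex \<alpha> \<beta> \<noteq> 0"
    and "\<And>z. z \<in> unit_disc \<Longrightarrow>
           Re (1 + z * deriv (deriv q) z / deriv q z)
             > max 0 (- Re (of_nat p * Complex \<alpha> \<beta> / \<mu>))"
    and "f \<in> class_A p n"
    and "(\<lambda>z. quot p f z powr Complex \<alpha> \<beta>) holomorphic_on unit_disc"
    and "(\<lambda>z. (1 + \<mu>) * quot p f z powr Complex \<alpha> \<beta>
              - \<mu> * log_quot p f z * quot p f z powr Complex \<alpha> \<beta>)
         \<prec> (\<lambda>z. q z + \<mu> * (z * deriv q z / (of_nat p * Complex \<alpha> \<beta>)))"
  shows "(\<lambda>z. quot p f z powr Complex \<alpha> \<beta>) \<prec> q \<and>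
         best_dominant
           (\<lambda>\<Phi>. (\<lambda>z. \<Phi> z + \<mu> / (of_nat p * Complex \<alpha> \<beta>) * (z * deriv \<Phi> z))
                 \<prec> (\<lambda>z. q z + \<mu> / (of_nat p * Complex \<alpha> \<beta>) * (z * deriv q z)))
           q"
proof -
  define c where "c = Complex \<alpha> \<beta>"
  define \<gamma> where "\<gamma> = \<mu> / (of_nat p * c)"
  define Q where "Q = quot p f"
  define D where "D = (\<lambda>\<Phi>. (\<lambda>z. \<Phi> z + \<gamma> * (z * deriv \<Phi> z)) \<prec> (\<lambda>z. q z + \<gamma> * (z * deriv q z)))"
  have pc: "of_nat p * c \<noteq> 0" using assms(1,6) by (simp add: c_def)
  have \<gamma>: "\<gamma> \<noteq> 0" using pc assms(4) by (simp add: \<gamma>_def)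
  \<comment> \<open>The \<open>0\<close> in the maximum gives convexity here; the other entry gives
    the lower bound used in \<open>main\<close>, because \<open>1 / \<gamma>\<close> equals
    \<open>of_nat p * c / \<mu>\<close>.\<close>
  interpret convex_map q
    using assms(3,7) by unfold_locales auto
  \<comment> \<open>Covering every solution makes \<open>q\<close> a dominant; the power of
    \<open>Q\<close> is then one instance.\<close>
  have main: "\<Phi> \<prec> q" if "\<Phi> holomorphic_on unit_disc" "D \<Phi>" for \<Phi>
  proof (rule differential_subordination[OF \<gamma> _ that(1)])
    show "- Re (1 / \<gamma>) < Re (1 + z * deriv (deriv q) z / deriv q z)" if "z \<in> unit_disc" for z
      using assms(7)[OF that] by (simp add: \<gamma>_def c_def)
    show "(\<lambda>z. \<Phi> z + \<gamma> * (z * deriv \<Phi> z)) \<prec> (\<lambda>z. q z + \<gamma> * (z * deriv q z))"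
      using that(2) unfolding D_def .
  qed
  have "D q"
    unfolding D_def subordinate_def
    by (intro conjI exI[of _ "\<lambda>z. z"] holomorphic_intros holo_q holo_deriv_q) auto
  then have best: "best_dominant D q"
    using main univalent_q holo_q by (auto simp: best_dominant_def dominant_def)
  obtain F where holF: "F holomorphic_on unit_disc" and F0: "F 0 = 1"
    and F: "\<And>z. z \<in> unit_disc \<Longrightarrow> F z \<noteq> 0" "\<And>z. z \<in> unit_disc \<Longrightarrow> f z = z ^ p * F z"
    using class_A_factorization[OF assms(1,2,8)] by metis
  \<comment> \<open>This includes the origin, where both sides are \<open>1\<close>, so the extended
    quotient is holomorphic.\<close>
  have Q: "Q z = 1 / F z" if "z \<in> unit_disc" for z
    using F[OF that] F0 by (simp add: Q_def quot_def)
  have holQ: "Q holomorphic_on unit_disc"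
    by (rule holomorphic_transform[of "\<lambda>z. 1 / F z"]) (auto intro!: holomorphic_intros holF simp: F Q)
  \<comment> \<open>Here \<open>z Q' / Q = p (1 - log_quot)\<close> and
    \<open>\<gamma> c = \<mu> / p\<close>, so the derivative term is
    \<open>\<mu> (1 - log_quot)\<close> times the power.\<close>
  have eq: "(1 + \<mu>) * Q z powr c - \<mu> * log_quot p f z * Q z powr c
      = Q z powr c + \<gamma> * (z * deriv (\<lambda>z. Q z powr c) z)" if z: "z \<in> unit_disc" for z
  proof -
    have dF: "(F has_field_derivative deriv F z) (at z)"
      by (rule holomorphic_derivI[OF holF open_ball z])
    have "deriv Q z = deriv (\<lambda>z. 1 / F z) z"
      by (rule complex_derivative_transform_within_open[OF holQ _ open_ball z Q])
        (auto intro!: holomorphic_intros holF simp: F)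
    also have "\<dots> = - deriv F z / (F z * F z)"
      by (rule DERIV_imp_deriv) (use F(1)[OF z] in \<open>auto intro!: derivative_eq_intros dF\<close>)
    finally have "deriv Q z / Q z = - deriv F z / F z"
      using F(1)[OF z] by (simp add: Q[OF z])
    then have dP: "deriv (\<lambda>z. Q z powr c) z = - c * (deriv F z / F z) * Q z powr c"
      using deriv_powr_unit_disc[of Q c z, OF holQ _ _ _ z] assms(9) F Q
      by (simp add: Q_def quot_def c_def)
    \<comment> \<open>At the origin the assigned value \<open>1\<close> fits, since the second
      summand vanishes there.\<close>
    have lq: "log_quot p f z = 1 + z * deriv F z / (of_nat p * F z)"
    proof (cases "z = 0")
      case False
      have "deriv f z = deriv (\<lambda>z. z ^ p * F z) z"
      proof (rule complex_derivative_transform_within_open[OF _ _ open_ball z F(2)])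
        show "f holomorphic_on unit_disc"
          using assms(8) by (simp add: class_A_def p_valent_def)
      qed (auto intro!: holomorphic_intros holF)
      also have "\<dots> = of_nat p * z ^ (p - 1) * F z + z ^ p * deriv F z"
        by (rule DERIV_imp_deriv) (auto intro!: derivative_eq_intros dF)
      finally have "z * deriv f z = of_nat p * z ^ p * F z + z * z ^ p * deriv F z"
        using assms(1) by (cases p) (simp_all add: algebra_simps)
      then show ?thesis
        using False F[OF z] assms(1) by (simp add: log_quot_def field_simps)
    qed (simp add: log_quot_def)
    show ?thesis
      unfolding dP lq using pc F(1)[OF z] by (simp add: \<gamma>_def field_simps)
  qed
  have "(\<lambda>z. Q z powr c) \<prec> q"
  proof (rule main)
    show hol: "(\<lambda>z. Q z powr c) holomorphic_on unit_disc"
      using assms(9) by (simp add: Q_def c_def)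
    have "(\<lambda>z. (1 + \<mu>) * Q z powr c - \<mu> * log_quot p f z * Q z powr c)
        \<prec> (\<lambda>z. q z + \<gamma> * (z * deriv q z))"
      using assms(10) by (simp add: Q_def c_def \<gamma>_def)
    from subordinate_cong[OF this eq] show "D (\<lambda>z. Q z powr c)"
      unfolding D_def .
  qed
  then show ?thesis
    using best by (simp add: Q_def c_def D_def \<gamma>_def)
qed

end
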